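(* Let $\mathcal{T}$ be a topology on a finite set $S$. A collection $\mathcal{B}\subseteq\mathcal{P}(S)$ satisfies $\operatorname{gen}(\mathcal{B})=\mathcal{T}$ (and is therefore a topological basis on $S$) if and only if $$\mathcal{M}_{\mathcal{T}}\subseteq\mathcal{B}\subseteq\mathcal{T}.$$
   Context: A topology $\mathcal{T}$ on $S$ is identified with its family of open sets. For $\mathcal{B}\subseteq\mathcal{P}(S)$, $\operatorname{gen}(\mathcal{B})=\{\bigcup\mathcal{C} : \mathcal{C}\subseteq\mathcal{B}\}$ is the collection of all unions of subfamilies of $\mathcal{B}$ (the empty union being $\emptyset$). A family $\mathcal{B}\subseteq\mathcal{P}(S)$ is a topological basis on $S$ if (1) $\bigcup_{B\in\mathcal{B}}B=S$, and (2) for all $B_1,B_2\in\mathcal{B}$ and all $x\in B_1\cap B_2$ there is $B_3\in\mathcal{B}$ with $x\in B_3\subseteq B_1\cap B_2$. For $x\in S$, $U_x=\bigcap\{U\in\mathcal{T} : x\in U\}$ is the minimal open neighborhood of $x$, and $\mathcal{M}_{\mathcal{T}}=\{U_x : x\in S\}$. *)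

theory Defs
  imports "HOL-Analysis.Abstract_Topology"
begin

text \<open>A topology on \<open>S\<close> is a library topology \<open>T\<close> with \<open>topspace T = S\<close>.\<close>

definition opens :: "'a topology \<Rightarrow> 'a set set" where
  "opens T = {U. openin T U}"

definition gen :: "'a set set \<Rightarrow> 'a set set" where
  "gen B = {\<Union>C |C. C \<subseteq> B}"

text \<open>The library's \<open>topological_basis\<close> refers to the type class topology on a whole type;
  here the carrier is a set and the notion does not presuppose a topology.\<close>

definition basis_on :: "'a set \<Rightarrow> 'a set set \<Rightarrow> bool" where
  "basis_on S B \<longleftrightarrow> B \<subseteq> Pow S \<and> \<Union>B = S \<and>
     (\<forall>B1\<in>B. \<forall>B2\<in>B. \<forall>x\<in>B1 \<inter> B2. \<exists>B3\<in>B. x \<in> B3 \<and> B3 \<subseteq> B1 \<inter> B2)"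

definition min_nbhd :: "'a topology \<Rightarrow> 'a \<Rightarrow> 'a set" where
  "min_nbhd T x = \<Inter>{U \<in> opens T. x \<in> U}"

definition min_nbhds :: "'a topology \<Rightarrow> 'a set set" where
  "min_nbhds T = {min_nbhd T x |x. x \<in> topspace T}"

end

theory Submission
  imports Defs
begin

text \<open>On a finite space \<open>min_nbhd T x\<close> is itself open, hence the least open set containing \<open>x\<close>.
  Writing it as a union of members of \<open>B\<close>, some member contains \<open>x\<close>, and by minimality that
  member is all of \<open>min_nbhd T x\<close>. Conversely every open set is the union of the
  minimal neighbourhoods of its points.\<close>

text \<open>If each point of \<open>U\<close> has such a \<open>V\<close>, the family of all members
  of \<open>B\<close> inside \<open>U\<close> already has union \<open>U\<close>. This pointwise
  criterion replaces the choice of a subfamily in the later arguments.\<close>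

lemma mem_gen_iff: "U \<in> gen B \<longleftrightarrow> (\<forall>x\<in>U. \<exists>V\<in>B. x \<in> V \<and> V \<subseteq> U)"
proof
  assume "U \<in> gen B"
  then show "\<forall>x\<in>U. \<exists>V\<in>B. x \<in> V \<and> V \<subseteq> U"
    by (auto simp: gen_def)
next
  assume "\<forall>x\<in>U. \<exists>V\<in>B. x \<in> V \<and> V \<subseteq> U"
  then have "U = \<Union>{V \<in> B. V \<subseteq> U}"
    by blast
  then show "U \<in> gen B"
    unfolding gen_def by blast
qed

lemma subset_gen: "B \<subseteq> gen B"
  by (auto simp: mem_gen_iff)

lemma mem_min_nbhd: "x \<in> min_nbhd T x"
  by (simp add: min_nbhd_def)

lemma min_nbhd_subset: "U \<in> opens T \<Longrightarrow> x \<in> U \<Longrightarrow> min_nbhd T x \<subseteq> U"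
  by (auto simp: min_nbhd_def)

lemma min_nbhd_in_opens:
  assumes "finite (topspace T)" and "x \<in> topspace T"
  shows "min_nbhd T x \<in> opens T"
proof -
  have "opens T \<subseteq> Pow (topspace T)"
    by (auto simp: opens_def dest: openin_subset)
  then have "finite {U \<in> opens T. x \<in> U}"
    using assms(1) by (simp add: finite_subset)
  \<comment> \<open>\<open>openin_Inter\<close> needs a nonempty family: the empty intersection
    would be \<open>UNIV\<close>.\<close>
  moreover have "topspace T \<in> {U \<in> opens T. x \<in> U}"
    using assms(2) by (simp add: opens_def)
  ultimately have "openin T (\<Inter>{U \<in> opens T. x \<in> U})"
    by (intro openin_Inter) (auto simp: opens_def)
  then show ?thesis
    by (simp add: min_nbhd_def opens_def)
qed

lemma gen_subset_opens: "B \<subseteq> opens T \<Longrightarrow> gen B \<subseteq> opens T"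
  by (auto simp: gen_def opens_def)

lemma min_nbhds_subset_if_gen_eq_opens:
  assumes "finite (topspace T)" and "gen B = opens T"
  shows "min_nbhds T \<subseteq> B"
proof
  fix U assume "U \<in> min_nbhds T"
  then obtain x where x: "x \<in> topspace T" and U: "U = min_nbhd T x"
    by (auto simp: min_nbhds_def)
  have "U \<in> gen B"
    using min_nbhd_in_opens[OF assms(1) x] assms(2) U by simp
  then obtain V where V: "V \<in> B" "x \<in> V" "V \<subseteq> U"
    using mem_min_nbhd U unfolding mem_gen_iff by metis
  \<comment> \<open>Minimality of \<open>min_nbhd T x\<close> applies only to open sets;
    \<open>V\<close> is one because \<open>B\<close> lies in \<open>gen B\<close>.\<close>
  have "V \<in> opens T"
    using V(1) subset_gen assms(2) by blast
  then have "V = U"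
    using V(2,3) U by (simp add: min_nbhd_subset subset_antisym)
  then show "U \<in> B"
    using V(1) by simp
qed

lemma opens_subset_gen_if_min_nbhds_subset:
  assumes "min_nbhds T \<subseteq> B"
  shows "opens T \<subseteq> gen B"
proof
  fix U assume U: "U \<in> opens T"
  \<comment> \<open>The minimal neighbourhood of \<open>x\<close> is the witness that
    \<open>mem_gen_iff\<close> asks for.\<close>
  have "min_nbhd T x \<in> B \<and> x \<in> min_nbhd T x \<and> min_nbhd T x \<subseteq> U" if "x \<in> U" for x
  proof -
    have "x \<in> topspace T"
      using U that by (auto simp: opens_def dest: openin_subset)
    then have "min_nbhd T x \<in> B"
      using assms by (auto simp: min_nbhds_def)
    then show ?thesis
      by (simp add: mem_min_nbhd min_nbhd_subset[OF U that])
  qed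
  then show "U \<in> gen B"
    unfolding mem_gen_iff by blast
qed

text \<open>Both basis axioms are instances of \<open>refine\<close>: the covering axiom for the
  open set \<open>topspace T\<close>, the intersection axiom for \<open>B1 \<inter> B2\<close>,
  which is open since \<open>B1\<close> and \<open>B2\<close> are.\<close>

lemma basis_on_if_gen_eq_opens:
  assumes "gen B = opens T"
  shows "basis_on (topspace T) B"
proof -
  have B_open: "openin T V" if "V \<in> B" for V
    using that subset_gen assms by (auto simp: opens_def)
  then have sub: "B \<subseteq> Pow (topspace T)"
    by (auto dest: openin_subset)
  have refine: "\<exists>V\<in>B. x \<in> V \<and> V \<subseteq> U" if "openin T U" "x \<in> U" for U x
  proof -
    have "U \<in> gen B"
      using that(1) assms by (simp add: opens_def)
    then show ?thesis
      using that(2) by (simp add: mem_gen_iff)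
  qed
  have "\<Union>B = topspace T"
    using sub refine[OF openin_topspace] by blast
  moreover have "\<forall>B1\<in>B. \<forall>B2\<in>B. \<forall>x\<in>B1 \<inter> B2. \<exists>B3\<in>B. x \<in> B3 \<and> B3 \<subseteq> B1 \<inter> B2"
    by (meson B_open openin_Int refine)
  ultimately show ?thesis
    using sub by (simp add: basis_on_def)
qed

theorem mainTheorem2:
  fixes S :: "'a set" and T :: "'a topology" and B :: "'a set set"
  assumes "finite S" and "topspace T = S" and "B \<subseteq> Pow S"
  shows "(gen B = opens T \<longleftrightarrow> min_nbhds T \<subseteq> B \<and> B \<subseteq> opens T)
    \<and> (gen B = opens T \<longrightarrow> basis_on S B)"
proof (intro conjI iffI impI)
  assume gen: "gen B = opens T"
  show "min_nbhds T \<subseteq> B"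
    using min_nbhds_subset_if_gen_eq_opens gen assms(1,2) by blast
  show "B \<subseteq> opens T"
    using subset_gen gen by blast
  show "basis_on S B"
    using basis_on_if_gen_eq_opens[OF gen] assms(2) by simp
next
  assume "min_nbhds T \<subseteq> B \<and> B \<subseteq> opens T"
  then show "gen B = opens T"
    using gen_subset_opens opens_subset_gen_if_min_nbhds_subset by blast
qed

end
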